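(* Let $\mathcal H$ be a real Hilbert space, let $A,B:\mathcal H\to2^{\mathcal H}$ be maximal monotone, let $C:\mathcal H\to\mathcal H$ be $\beta$-cocoercive with $\beta>0$, let $\gamma\in(0,2\beta)$, and let $T:=I_{\mathcal H}-J_{\gamma B}+J_{\gamma A}\circ(2J_{\gamma B}-I_{\mathcal H}-\gamma C\circ J_{\gamma B})$. Then $$\mathrm{zer}(A+B+C)=J_{\gamma B}(\mathrm{Fix}\,T).$$ In addition, $$\mathrm{Fix}\,T=\{x+\gamma u\mid 0\in(A+B+C)x,\ u\in(Bx)\cap(-Ax-Cx)\}.$$
   Context: $C$ is $\beta$-cocoercive if $\langle Cx-Cy,x-y\rangle\ge\beta\|Cx-Cy\|^2$ for all $x,y$. $J_S:=(I_{\mathcal H}+S)^{-1}$ is the resolvent; $\mathrm{zer}(S)=\{x:0\in Sx\}$; $\mathrm{Fix}\,T$ is the fixed-point set of $T$. *)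

theory Defs
  imports "HOL-Analysis.Analysis" "HOL-Library.Set_Algebras"
begin

text \<open>
  A set-valued operator on \<open>'a\<close> is a function of type \<open>'a \<Rightarrow> 'a set\<close>. On sets, \<open>+\<close> is the
  Minkowski sum. Pitfall: on sets, unary and binary minus remain complement and set difference,
  so the negative of a set is written as an image.
\<close>

definition monotone_op :: "('a::real_inner \<Rightarrow> 'a set) \<Rightarrow> bool" where
  "monotone_op S \<longleftrightarrow> (\<forall>x y. \<forall>u\<in>S x. \<forall>v\<in>S y. 0 \<le> (x - y) \<bullet> (u - v))"

text \<open>Maximality is with respect to inclusion of graphs.\<close>

definition maximal_monotone :: "('a::real_inner \<Rightarrow> 'a set) \<Rightarrow> bool" where
  "maximal_monotone S \<longleftrightarrow> monotone_op S \<and>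
     (\<forall>S'. monotone_op S' \<and> (\<forall>x. S x \<subseteq> S' x) \<longrightarrow> S' = S)"

definition cocoercive :: "real \<Rightarrow> ('a::real_inner \<Rightarrow> 'a) \<Rightarrow> bool" where
  "cocoercive \<beta> C \<longleftrightarrow> (\<forall>x y. (C x - C y) \<bullet> (x - y) \<ge> \<beta> * (norm (C x - C y))\<^sup>2)"

definition scale_op :: "real \<Rightarrow> ('a::real_vector \<Rightarrow> 'a set) \<Rightarrow> 'a \<Rightarrow> 'a set" where
  "scale_op c S x = (\<lambda>u. c *\<^sub>R u) ` S x"

definition inverse_op :: "('a \<Rightarrow> 'a set) \<Rightarrow> 'a \<Rightarrow> 'a set" where
  "inverse_op S y = {x. y \<in> S x}"

text \<open>
  The set-valued inverse \<open>(I + S)\<inverse>\<close> is single-valued and everywhere defined when \<open>S\<close> is maximal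
  monotone on a Hilbert space (Minty); as usual, it is then identified with a function.
  The value is unspecified where \<open>(I + S)\<inverse>\<close> is not a singleton.
\<close>

definition resolvent :: "('a::real_vector \<Rightarrow> 'a set) \<Rightarrow> 'a \<Rightarrow> 'a" where
  "resolvent S y = the_elem (inverse_op (\<lambda>x. {x} + S x) y)"

definition zer :: "('a::zero \<Rightarrow> 'a set) \<Rightarrow> 'a set" where
  "zer S = {x. 0 \<in> S x}"

definition Fix :: "('a \<Rightarrow> 'a) \<Rightarrow> 'a set" where
  "Fix T = {x. T x = x}"

end

theory Submission
  imports Defs
begin

text \<open>
  The analytic input is Minty's theorem. A point \<open>x\<close> with \<open>z - x \<in> S x\<close> is one at which all the
  functions \<open>\<langle>x - y, x - z + v\<rangle>\<close>, for \<open>(y, v)\<close> in the graph of \<open>S\<close>, are nonpositive. These are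
  \<open>\<parallel>x\<parallel>\<^sup>2\<close> plus affine functions of \<open>x\<close>, so the dual problem minimises \<open>\<parallel>a\<parallel>\<^sup>2 + b\<close> over a convex
  set of pairs \<open>(a, b)\<close>. Minimising sequences are Cauchy in \<open>a\<close> by the parallelogram law,
  so neither weak compactness nor a minimax theorem is needed; monotonicity makes the dual value
  nonnegative, and the optimality condition at the limit produces \<open>x\<close>.
  Given Minty's theorem, both identities follow by writing \<open>z = x + \<gamma> u\<close> with \<open>u \<in> B x\<close>.
\<close>

section \<open>Minimisation over a convex set of pairs\<close>

text \<open>For fixed \<open>(a, b)\<close> the maximum over \<open>x\<close> of
  \<open>2 * (x \<bullet> a) - (norm x)\<^sup>2 + b\<close> is \<open>(norm a)\<^sup>2 + b\<close>,
  attained at \<open>x = a\<close>. So each inequality is solvable separately by hypothesis; the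
  dual minimiser solves all at once.\<close>

lemma strongly_convex_dual_point:
  fixes Q :: "('a::{real_inner, complete_space} \<times> real) set"
  assumes Q: "convex Q" and nonneg: "\<And>a b. (a, b) \<in> Q \<Longrightarrow> 0 \<le> (norm a)\<^sup>2 + b"
  shows "\<exists>x. \<forall>(a, b)\<in>Q. 0 \<le> 2 * (x \<bullet> a) - (norm x)\<^sup>2 + b"
proof (cases "Q = {}")
  case False
  define G where "G = (\<lambda>(a::'a, b::real). a \<bullet> a + b)"
  define d where "d = Inf (G ` Q)"
  have G0: "0 \<le> G q" if "q \<in> Q" for q
    using nonneg[of "fst q" "snd q"] that by (auto simp: G_def power2_norm_eq_inner split: prod.splits)
  have bdd: "bdd_below (G ` Q)"
    using G0 by (intro bdd_belowI[of _ 0]) auto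
  have dle: "d \<le> G q" if "q \<in> Q" for q
    unfolding d_def using bdd that by (intro cInf_lower) auto
  have d0: "0 \<le> d"
    unfolding d_def using False G0 by (intro cInf_greatest) auto
  have "\<exists>q\<in>Q. G q < d + 1 / Suc n" for n
  proof -
    have "Inf (G ` Q) < d + 1 / Suc n" by (simp add: d_def)
    then show ?thesis using False bdd by (subst (asm) cInf_less_iff) auto
  qed
  then obtain q where qQ: "\<And>n. q n \<in> Q" and qd: "\<And>n. G (q n) < d + 1 / Suc n"
    by metis
  define a b where "a = (\<lambda>n. fst (q n))" and "b = (\<lambda>n. snd (q n))"
  have abQ: "(a n, b n) \<in> Q" and Gab: "G (q n) = a n \<bullet> a n + b n" for n
    using qQ[of n] by (auto simp: a_def b_def G_def split: prod.splits)
  \<comment> \<open>The midpoint lies in \<open>Q\<close>, so \<open>G\<close> is at least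
    \<open>d\<close> there. In the parallelogram identity the \<open>b\<close> terms cancel, which
    leaves twice the sum of the two excesses of \<open>G\<close> over \<open>d\<close>.\<close>
  have close: "(norm (a m - a n))\<^sup>2 \<le> 2 / Suc m + 2 / Suc n" for m n
  proof -
    have "(1/2) *\<^sub>R (a m, b m) + (1/2) *\<^sub>R (a n, b n) \<in> Q"
      using Q abQ by (intro convexD) auto
    from dle[OF this] have "d \<le> ((1/2) *\<^sub>R a m + (1/2) *\<^sub>R a n) \<bullet> ((1/2) *\<^sub>R a m + (1/2) *\<^sub>R a n) + b m / 2 + b n / 2"
      by (simp add: G_def)
    moreover have "(norm (a m - a n))\<^sup>2 = 2 * (a m \<bullet> a m) + 2 * (a n \<bullet> a n)
        - 4 * (((1/2) *\<^sub>R a m + (1/2) *\<^sub>R a n) \<bullet> ((1/2) *\<^sub>R a m + (1/2) *\<^sub>R a n))"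
      by (simp add: power2_norm_eq_inner inner_simps inner_commute algebra_simps)
    ultimately show ?thesis
      using qd[of m] qd[of n] unfolding Gab by simp
  qed
  have "Cauchy a"
  proof (rule metric_CauchyI)
    fix e :: real assume e: "0 < e"
    obtain N where N: "inverse (Suc N) < e\<^sup>2 / 4"
      using reals_Archimedean[of "e\<^sup>2 / 4"] e by auto
    show "\<exists>M. \<forall>m\<ge>M. \<forall>n\<ge>M. dist (a m) (a n) < e"
    proof (intro exI allI impI)
      fix m n assume "N \<le> m" "N \<le> n"
      then have "inverse (real (Suc m)) \<le> inverse (real (Suc N))"
        "inverse (real (Suc n)) \<le> inverse (real (Suc N))"
        by (auto intro!: le_imp_inverse_le)
      moreover have "(norm (a m - a n))\<^sup>2 \<le> 2 * inverse (real (Suc m)) + 2 * inverse (real (Suc n))"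
        using close[of m n] by (simp only: divide_inverse)
      ultimately have "(norm (a m - a n))\<^sup>2 < e\<^sup>2"
        using N by linarith
      then show "dist (a m) (a n) < e"
        using e by (simp add: dist_norm power_less_imp_less_base)
    qed
  qed
  then obtain x where ax: "a \<longlonglongrightarrow> x"
    using Cauchy_convergent_iff convergent_def by blast
  have "(\<lambda>n. G (q n)) \<longlonglongrightarrow> d"
  proof (rule tendsto_sandwich)
    show "\<forall>\<^sub>F n in sequentially. d \<le> G (q n)" using dle qQ by simp
    show "\<forall>\<^sub>F n in sequentially. G (q n) \<le> d + inverse (real (Suc n))"
      using qd by (auto intro!: always_eventually less_imp_le simp: inverse_eq_divide)
    show "(\<lambda>n. d + inverse (real (Suc n))) \<longlonglongrightarrow> d"
      by (rule LIMSEQ_inverse_real_of_nat_add)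
  qed simp
  \<comment> \<open>The limit \<open>(x, d - x \<bullet> x)\<close> need not lie in
    \<open>Q\<close>, so optimality is tested below along the sequence and only then passed to the
    limit.\<close>
  then have "(\<lambda>n. G (q n) - a n \<bullet> a n) \<longlonglongrightarrow> d - x \<bullet> x"
    by (intro tendsto_intros ax)
  then have bx: "b \<longlonglongrightarrow> d - x \<bullet> x"
    by (simp add: Gab)
  have "0 \<le> 2 * (x \<bullet> a') - (norm x)\<^sup>2 + b'" if ab': "(a', b') \<in> Q" for a' b'
  proof -
    \<comment> \<open>On the segment from the limit point to \<open>(a', b')\<close>,
      \<open>G\<close> equals \<open>d + t * (X + t * Y)\<close>. Thus \<open>X\<close> is the
      one-sided derivative at 0, and it is the desired quantity minus \<open>d\<close>.\<close>
    define X where "X = 2 * (x \<bullet> a') - x \<bullet> x + b' - d"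
    define Y where "Y = (a' - x) \<bullet> (a' - x)"
    have ineq: "0 \<le> X + t * Y" if t: "0 < t" "t < 1" for t
    proof -
      let ?p = "\<lambda>y c. ((1 - t) *\<^sub>R y + t *\<^sub>R a') \<bullet> ((1 - t) *\<^sub>R y + t *\<^sub>R a') + ((1 - t) * c + t * b')"
      have "d \<le> ?p (a n) (b n)" for n
      proof -
        have "(1 - t) *\<^sub>R (a n, b n) + t *\<^sub>R (a', b') \<in> Q"
          using Q abQ ab' t by (intro convexD) auto
        from dle[OF this] show ?thesis by (simp add: G_def)
      qed
      moreover have "(\<lambda>n. ?p (a n) (b n)) \<longlonglongrightarrow> ?p x (d - x \<bullet> x)"
        by (intro tendsto_intros ax bx)
      ultimately have "d \<le> ?p x (d - x \<bullet> x)"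
        by (intro LIMSEQ_le_const) auto
      also have "\<dots> = d + t * (X + t * Y)"
        by (simp add: X_def Y_def inner_simps inner_commute algebra_simps)
      finally show ?thesis using t by (simp add: zero_le_mult_iff)
    qed
    have "((\<lambda>t. X + t * Y) \<longlongrightarrow> X + 0 * Y) (at_right 0)"
      by (intro tendsto_intros)
    then have "0 \<le> X + 0 * Y"
    proof (rule tendsto_lowerbound)
      show "\<forall>\<^sub>F t in at_right 0. 0 \<le> X + t * Y"
        using ineq by (auto simp: eventually_at_right_field intro!: exI[of _ 1])
    qed simp
    then show ?thesis
      using d0 by (simp add: X_def power2_norm_eq_inner)
  qed
  then show ?thesis by blast
qed simp

section \<open>Points related to a monotone set\<close>

text \<open>
  On the convex hull of the points \<open>(y, v, \<langle>y, v\<rangle>)\<close>, the last coordinate dominates the inner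
  product of the first two: for fixed \<open>(y', v')\<close>, monotonicity is an affine condition.
\<close>

lemma monotone_hull_inner_le:
  fixes M :: "('a::real_inner \<times> 'a) set"
  assumes mono: "\<And>y v y' v'. (y, v) \<in> M \<Longrightarrow> (y', v') \<in> M \<Longrightarrow> 0 \<le> (y - y') \<bullet> (v - v')"
    and hull: "(y, v, b) \<in> convex hull ((\<lambda>(y, v). (y, v, y \<bullet> v)) ` M)"
  shows "y \<bullet> v \<le> b"
proof -
  let ?L = "(\<lambda>(y, v). (y, v, y \<bullet> v)) ` M"
  \<comment> \<open>Between two lifted points, membership in \<open>H\<close> is exactly the
    monotonicity inequality; \<open>H\<close> extends it to all triples as a symmetric relation,
    affine in each argument.\<close>
  define H :: "'a \<times> 'a \<times> real \<Rightarrow> ('a \<times> 'a \<times> real) set" where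
    "H = (\<lambda>(y', v', b'). {(y, v, b). y' \<bullet> v + y \<bullet> v' - b \<le> b'})"
  have convH: "convex (H p)" for p
  proof -
    obtain y' v' b' where p: "p = (y', v', b')" by (cases p)
    let ?f = "\<lambda>(y, v, b). y' \<bullet> v + y \<bullet> v' - b"
    have "linear ?f"
      by (intro linearI) (auto simp: inner_simps algebra_simps)
    then have "convex (?f -` {..b'})"
      by (rule convex_linear_vimage) simp
    moreover have "H p = ?f -` {..b'}" by (auto simp: H_def p)
    ultimately show ?thesis by simp
  qed
  have symH: "p \<in> H p' \<longleftrightarrow> p' \<in> H p" for p p'
    by (cases p; cases p') (auto simp: H_def inner_commute algebra_simps)
  have LL: "?L \<subseteq> H p" if "p \<in> ?L" for p
    using that by (fastforce dest: mono simp: H_def inner_simps algebra_simps)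
  have hullL: "convex hull ?L \<subseteq> H p" if "p \<in> ?L" for p
    using LL[OF that] convH by (intro hull_minimal) auto
  \<comment> \<open>Symmetry exchanges the arguments, so that convexity applies once more. The
    diagonal case then reads \<open>2 * (y \<bullet> v) \<le> 2 * b\<close>.\<close>
  have "?L \<subseteq> H (y, v, b)"
    using hullL hull symH by blast
  then have "convex hull ?L \<subseteq> H (y, v, b)"
    using convH by (intro hull_minimal) auto
  with hull have "(y, v, b) \<in> H (y, v, b)" by blast
  then show ?thesis by (simp add: H_def)
qed

text \<open>Expanding the product gives
  \<open>- (x \<bullet> x) - x \<bullet> (v - y) + y \<bullet> v\<close>, the dual form at the point
  \<open>- x\<close> with \<open>a = (v - y) / 2\<close> and \<open>b = y \<bullet> v\<close>. This
  is the normalised case of Minty's theorem.\<close>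

lemma monotone_extension_minus:
  fixes M :: "('a::{real_inner, complete_space} \<times> 'a) set"
  assumes mono: "\<And>y v y' v'. (y, v) \<in> M \<Longrightarrow> (y', v') \<in> M \<Longrightarrow> 0 \<le> (y - y') \<bullet> (v - v')"
  shows "\<exists>x. \<forall>(y, v)\<in>M. 0 \<le> (x - y) \<bullet> (- x - v)"
proof -
  let ?L = "(\<lambda>(y, v). (y, v, y \<bullet> v)) ` M"
  define f :: "'a \<times> 'a \<times> real \<Rightarrow> 'a \<times> real" where
    "f = (\<lambda>(y, v, b). ((1/2) *\<^sub>R (v - y), b))"
  have "linear f"
    by (intro linearI) (auto simp: f_def algebra_simps)
  then have "convex (f ` (convex hull ?L))"
    by (intro convex_linear_image) auto
  moreover have "0 \<le> (norm a)\<^sup>2 + b" if "(a, b) \<in> f ` (convex hull ?L)" for a b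
  proof -
    from that obtain y v where a: "a = (1/2) *\<^sub>R (v - y)" and "(y, v, b) \<in> convex hull ?L"
      by (auto simp: f_def)
    then have "y \<bullet> v \<le> b" by (intro monotone_hull_inner_le[OF mono])
    \<comment> \<open>Completing the square is what makes the dual value nonnegative.\<close>
    moreover have "(norm a)\<^sup>2 + y \<bullet> v = (norm ((1/2) *\<^sub>R (v + y)))\<^sup>2"
      unfolding a power2_norm_eq_inner by (simp add: inner_simps inner_commute algebra_simps)
    ultimately show ?thesis by (smt (verit) zero_le_power2)
  qed
  ultimately have "\<exists>x. \<forall>(a, b)\<in>f ` (convex hull ?L). 0 \<le> 2 * (x \<bullet> a) - (norm x)\<^sup>2 + b"
    by (rule strongly_convex_dual_point)
  then obtain x where
    x: "\<forall>(a, b)\<in>f ` (convex hull ?L). 0 \<le> 2 * (x \<bullet> a) - (norm x)\<^sup>2 + b" ..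
  have "0 \<le> (- x - y) \<bullet> (- (- x) - v)" if "(y, v) \<in> M" for y v
  proof -
    have "(y, v, y \<bullet> v) \<in> convex hull ?L"
      using that by (intro hull_inc) auto
    then have "((1/2) *\<^sub>R (v - y), y \<bullet> v) \<in> f ` (convex hull ?L)"
      by (force simp: f_def)
    from bspec[OF x this] show ?thesis
      by (simp add: power2_norm_eq_inner inner_simps inner_commute algebra_simps)
  qed
  then have "\<forall>(y, v)\<in>M. 0 \<le> (- x - y) \<bullet> (- (- x) - v)" by auto
  then show ?thesis ..
qed

section \<open>Maximality and Minty's theorem\<close>

text \<open>Adjoining the pair \<open>(x, u)\<close> to the graph keeps it monotone, so by
  maximality it was already there.\<close>

lemma maximal_monotone_memI:
  assumes S: "maximal_monotone S"
    and rel: "\<And>y v. v \<in> S y \<Longrightarrow> 0 \<le> (x - y) \<bullet> (u - v)"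
  shows "u \<in> S x"
proof -
  define S' where "S' = S(x := insert u (S x))"
  have mono: "0 \<le> (y - y') \<bullet> (v - v')" if "v \<in> S y" "v' \<in> S y'" for y y' v v'
    using S that unfolding maximal_monotone_def monotone_op_def by blast
  have rel': "0 \<le> (y - x) \<bullet> (v - u)" if "v \<in> S y" for y v
    using rel[OF that] by (simp add: inner_diff_left inner_diff_right algebra_simps)
  have "monotone_op S'"
    using mono rel rel' unfolding monotone_op_def S'_def by (auto split: if_splits)
  moreover have "\<forall>y. S y \<subseteq> S' y" by (auto simp: S'_def)
  ultimately have "S' = S"
    using S unfolding maximal_monotone_def by blast
  then show ?thesis by (metis S'_def fun_upd_same insertI1)
qed

lemma minty:
  fixes S :: "'a::{real_inner, complete_space} \<Rightarrow> 'a set"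
  assumes S: "maximal_monotone S" and c: "0 < c"
  shows "\<exists>x. \<exists>u\<in>S x. z = x + c *\<^sub>R u"
proof -
  have mono: "0 \<le> (y - y') \<bullet> (v - v')" if "v \<in> S y" "v' \<in> S y'" for y y' v v'
    using S that unfolding maximal_monotone_def monotone_op_def by blast
  \<comment> \<open>Scaling and shifting normalise the problem: \<open>(x, - x)\<close> is related
    to \<open>M\<close> iff \<open>(x, (z - x) / c)\<close> is related to the graph of
    \<open>S\<close>.\<close>
  define M where "M = {(y, c *\<^sub>R v - z) | y v. v \<in> S y}"
  have "0 \<le> (y - y') \<bullet> (w - w')" if w: "(y, w) \<in> M" "(y', w') \<in> M" for y w y' w'
  proof -
    obtain v v' where v: "v \<in> S y" "v' \<in> S y'" "w = c *\<^sub>R v - z" "w' = c *\<^sub>R v' - z"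
      using w unfolding M_def by blast
    then have "w - w' = c *\<^sub>R (v - v')"
      by (simp add: scaleR_diff_right)
    then show ?thesis using mono v c by simp
  qed
  then have "\<exists>x. \<forall>(y, w)\<in>M. 0 \<le> (x - y) \<bullet> (- x - w)"
    by (rule monotone_extension_minus)
  then obtain x where x: "\<forall>(y, w)\<in>M. 0 \<le> (x - y) \<bullet> (- x - w)" ..
  have "(1/c) *\<^sub>R (z - x) \<in> S x"
  proof (rule maximal_monotone_memI[OF S])
    fix y v assume "v \<in> S y"
    then have "(y, c *\<^sub>R v - z) \<in> M"
      unfolding M_def by blast
    with x have "0 \<le> (x - y) \<bullet> (- x - (c *\<^sub>R v - z))"
      by auto
    also have "- x - (c *\<^sub>R v - z) = c *\<^sub>R ((1/c) *\<^sub>R (z - x) - v)"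
      using c by (simp add: algebra_simps)
    finally show "0 \<le> (x - y) \<bullet> ((1/c) *\<^sub>R (z - x) - v)"
      using c by (simp add: zero_le_mult_iff)
  qed
  moreover have "z = x + c *\<^sub>R ((1/c) *\<^sub>R (z - x))"
    using c by simp
  ultimately show ?thesis by blast
qed

section \<open>Resolvents as functions\<close>

lemma monotone_resolvent_unique:
  assumes S: "monotone_op S" and c: "0 < c"
    and u: "u \<in> S x" and v: "v \<in> S y" and eq: "x + c *\<^sub>R u = y + c *\<^sub>R v"
  shows "x = y"
proof -
  have "0 \<le> (x - y) \<bullet> (u - v)"
    using S u v unfolding monotone_op_def by blast
  then have "0 \<le> (x - y) \<bullet> (c *\<^sub>R (u - v))"
    using c by simp
  also have "c *\<^sub>R (u - v) = - (x - y)"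
    using eq by (simp add: algebra_simps)
  finally show ?thesis
    by (metis inner_minus_right neg_0_le_iff_le inner_ge_zero inner_eq_zero_iff order_antisym right_minus_eq)
qed

text \<open>Minty's theorem and uniqueness make the inverse image a singleton, so
  \<open>the_elem\<close> never takes its unspecified value. Every later use of resolvents goes
  through this equivalence.\<close>

lemma resolvent_scale_op_eq_iff:
  fixes S :: "'a::{real_inner, complete_space} \<Rightarrow> 'a set"
  assumes S: "maximal_monotone S" and c: "0 < c"
  shows "resolvent (scale_op c S) z = x \<longleftrightarrow> (\<exists>u\<in>S x. z = x + c *\<^sub>R u)"
proof -
  have inv: "inverse_op (\<lambda>x. {x} + scale_op c S x) z = {x. \<exists>u\<in>S x. z = x + c *\<^sub>R u}"
    by (auto simp: inverse_op_def scale_op_def set_plus_def)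
  obtain y where y: "\<exists>u\<in>S y. z = y + c *\<^sub>R u"
    using minty[OF S c] by blast
  have unique: "x = y" if "\<exists>u\<in>S x. z = x + c *\<^sub>R u" for x
    using that y monotone_resolvent_unique[of S c] S c
    unfolding maximal_monotone_def by metis
  have eq: "{x. \<exists>u\<in>S x. z = x + c *\<^sub>R u} = {y}"
    using y unique by blast
  then have "resolvent (scale_op c S) z = y"
    by (simp add: resolvent_def inv)
  moreover have "x = y \<longleftrightarrow> (\<exists>u\<in>S x. z = x + c *\<^sub>R u)"
    using arg_cong[OF eq, of "\<lambda>X. x \<in> X"] unfolding mem_Collect_eq singleton_iff by (rule sym)
  ultimately show ?thesis by (simp only: eq_commute[of y x])
qed

section \<open>Fixed points of the splitting operator\<close>

theorem lemma3p2:
  fixes A B :: "'a::{real_inner, complete_space} \<Rightarrow> 'a set"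
    and C T :: "'a \<Rightarrow> 'a"
    and \<beta> \<gamma> :: real
  assumes A: "maximal_monotone A"
    and B: "maximal_monotone B"
    and \<beta>: "\<beta> > 0"
    and C: "cocoercive \<beta> C"
    and \<gamma>: "\<gamma> \<in> {0<..<2 * \<beta>}"
    and T: "T = (\<lambda>z. z - resolvent (scale_op \<gamma> B) z
                   + resolvent (scale_op \<gamma> A)
                       (2 *\<^sub>R resolvent (scale_op \<gamma> B) z - z
                          - \<gamma> *\<^sub>R C (resolvent (scale_op \<gamma> B) z)))"
  shows "zer (\<lambda>x. A x + B x + {C x}) = resolvent (scale_op \<gamma> B) ` Fix T
    \<and> Fix T = {x + \<gamma> *\<^sub>R u | x u. 0 \<in> A x + B x + {C x} \<and>
                                   u \<in> B x \<inter> (\<lambda>a. - a - C x) ` A x}"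
proof -
  have \<gamma>0: "0 < \<gamma>" using \<gamma> by simp
  note JA = resolvent_scale_op_eq_iff[OF A \<gamma>0]
  note JB = resolvent_scale_op_eq_iff[OF B \<gamma>0]
  let ?JB = "resolvent (scale_op \<gamma> B)"
  have zero: "0 \<in> A x + B x + {C x} \<longleftrightarrow> (\<exists>u\<in>B x. - u - C x \<in> A x)" for x
  proof
    assume "0 \<in> A x + B x + {C x}"
    then obtain a u where "a \<in> A x" "u \<in> B x" "0 = a + u + C x"
      by (auto simp: set_plus_def)
    moreover from this have "a = - u - C x"
      by (metis add.commute add_diff_cancel diff_0 diff_diff_eq)
    ultimately show "\<exists>u\<in>B x. - u - C x \<in> A x" by blast
  next
    assume "\<exists>u\<in>B x. - u - C x \<in> A x"
    then obtain u where "u \<in> B x" "- u - C x \<in> A x" by blast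
    then have "(- u - C x) + u + C x \<in> A x + B x + {C x}"
      by (intro set_plus_intro) auto
    then show "0 \<in> A x + B x + {C x}" by simp
  qed
  have JB_eq: "?JB (x + \<gamma> *\<^sub>R u) = x" if "u \<in> B x" for x u
    using JB that by blast
  have fix_iff: "x + \<gamma> *\<^sub>R u \<in> Fix T \<longleftrightarrow> - u - C x \<in> A x" if u: "u \<in> B x" for x u
  proof -
    have "x + \<gamma> *\<^sub>R u \<in> Fix T \<longleftrightarrow>
        resolvent (scale_op \<gamma> A) (2 *\<^sub>R x - (x + \<gamma> *\<^sub>R u) - \<gamma> *\<^sub>R C x) = x"
      by (auto simp: Fix_def T JB_eq[OF u] algebra_simps)
    \<comment> \<open>The argument of the second resolvent again has the form
      \<open>x + \<gamma> *\<^sub>R w\<close>; it returns \<open>x\<close> iff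
      \<open>w = - u - C x\<close> lies in \<open>A x\<close>.\<close>
    also have "2 *\<^sub>R x - (x + \<gamma> *\<^sub>R u) - \<gamma> *\<^sub>R C x = x + \<gamma> *\<^sub>R (- u - C x)"
      by (simp add: algebra_simps scaleR_2)
    also have "resolvent (scale_op \<gamma> A) \<dots> = x \<longleftrightarrow> - u - C x \<in> A x"
      unfolding JA using \<gamma>0 by auto
    finally show ?thesis .
  qed
  have decompose: "\<exists>u\<in>B (?JB z). z = ?JB z + \<gamma> *\<^sub>R u" for z
    using JB by blast
  \<comment> \<open>Every \<open>z\<close> decomposes with \<open>x = ?JB z\<close>, so
    \<open>fix_iff\<close> reaches all of \<open>Fix T\<close>.\<close>
  have Fix_eq: "Fix T = {x + \<gamma> *\<^sub>R u | x u. u \<in> B x \<and> - u - C x \<in> A x}"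
  proof (intro set_eqI iffI)
    fix z assume z: "z \<in> Fix T"
    obtain u where u: "u \<in> B (?JB z)" and z_eq: "z = ?JB z + \<gamma> *\<^sub>R u"
      using decompose by blast
    moreover have "- u - C (?JB z) \<in> A (?JB z)"
      using fix_iff[OF u] z z_eq by simp
    ultimately show "z \<in> {x + \<gamma> *\<^sub>R u | x u. u \<in> B x \<and> - u - C x \<in> A x}" by blast
  next
    fix z assume "z \<in> {x + \<gamma> *\<^sub>R u | x u. u \<in> B x \<and> - u - C x \<in> A x}"
    then show "z \<in> Fix T" using fix_iff by blast
  qed
  have "zer (\<lambda>x. A x + B x + {C x}) = ?JB ` Fix T"
  proof (intro set_eqI iffI)
    fix x assume "x \<in> zer (\<lambda>x. A x + B x + {C x})"
    then obtain u where u: "u \<in> B x" "- u - C x \<in> A x"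
      by (auto simp: zer_def zero)
    then have "x + \<gamma> *\<^sub>R u \<in> Fix T" unfolding Fix_eq by blast
    then show "x \<in> ?JB ` Fix T" using JB_eq[OF u(1)] by (metis imageI)
  next
    fix x assume "x \<in> ?JB ` Fix T"
    then obtain y u where u: "u \<in> B y" "- u - C y \<in> A y" and x: "x = ?JB (y + \<gamma> *\<^sub>R u)"
      unfolding Fix_eq by blast
    then have "x = y" using JB_eq by simp
    with u show "x \<in> zer (\<lambda>x. A x + B x + {C x})"
      by (auto simp: zer_def zero)
  qed
  moreover have "u \<in> B x \<and> - u - C x \<in> A x \<longleftrightarrow>
      0 \<in> A x + B x + {C x} \<and> u \<in> B x \<inter> (\<lambda>a. - a - C x) ` A x" for x u
  proof -
    \<comment> \<open>The map \<open>\<lambda>a. - a - C x\<close> is its own inverse.\<close>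
    have "u \<in> (\<lambda>a. - a - C x) ` A x \<longleftrightarrow> - u - C x \<in> A x"
      by (auto simp: image_iff intro!: bexI[of _ "- u - C x"])
    then show ?thesis using zero by blast
  qed
  ultimately show ?thesis
    by (simp only: Fix_eq)
qed

end
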